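(* Let $n$ be a positive integer, let $Q = (Q_{u,i,v,j})_{u,i,v,j \in \{1,\ldots,n\}}$ be a real array, let $\hat{j} \in \{1,\ldots,n\}$, and let $\Delta \in \mathbb{R}$ be a constant. Define $\tilde{Q}$ by, for all $u,i,v,j \in \{1,\ldots,n\}$, $$\tilde{Q}_{u,i,v,j} = \begin{cases} Q_{u,i,v,j} & \text{if } j \neq \hat{j}, \\ Q_{u,i,v,j} + \Delta & \text{if } j = \hat{j}. \end{cases}$$ Consider the two optimization problems over binary variables $x = (x_{u,i}) \in \{0,1\}^{n \times n}$, $$(P)\quad \min \sum_{i=1}^n\sum_{j=1}^n\sum_{u=1}^n\sum_{v=1}^n x_{u,i}\,Q_{u,i,v,j}\,x_{v,j}, \qquad (\tilde{P})\quad \min \sum_{i=1}^n\sum_{j=1}^n\sum_{u=1}^n\sum_{v=1}^n x_{u,i}\,\tilde{Q}_{u,i,v,j}\,x_{v,j},$$ both subject to $\sum_{u=1}^n x_{u,i} = 1$ for all $i \in \{1,\ldots,n\}$ and $\sum_{i=1}^n x_{u,i} = 1$ for all $u \in \{1,\ldots,n\}$. If $y$ and $z$ are feasible solutions such that $y$ is better than $z$ for problem $(P)$, then $y$ is better than $z$ for problem $(\tilde{P})$.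
   Context: A feasible solution is a binary array satisfying all the stated constraints (both problems have the same feasible set). For a minimization problem, a feasible solution $y$ is better than a feasible solution $z$ if the objective value of $y$ is strictly smaller than the objective value of $z$. *)

theory Defs
  imports Complex_Main
begin

(* Arrays over {1..n} are total functions on nat; values at indices outside {1..n}
   are unconstrained and never enter the objective or the constraints. *)

definition feasible :: "nat \<Rightarrow> (nat \<Rightarrow> nat \<Rightarrow> real) \<Rightarrow> bool" where
  "feasible n x \<longleftrightarrow>
     (\<forall>u\<in>{1..n}. \<forall>i\<in>{1..n}. x u i \<in> {0, 1}) \<and>
     (\<forall>i\<in>{1..n}. (\<Sum>u=1..n. x u i) = 1) \<and>
     (\<forall>u\<in>{1..n}. (\<Sum>i=1..n. x u i) = 1)"

definition objective ::
  "nat \<Rightarrow> (nat \<Rightarrow> nat \<Rightarrow> nat \<Rightarrow> nat \<Rightarrow> real) \<Rightarrow> (nat \<Rightarrow> nat \<Rightarrow> real) \<Rightarrow> real" where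
  "objective n Q x =
     (\<Sum>i=1..n. \<Sum>j=1..n. \<Sum>u=1..n. \<Sum>v=1..n. x u i * Q u i v j * x v j)"

(* Only meant for feasible y and z; feasibility is not part of the definition. *)
definition better ::
  "nat \<Rightarrow> (nat \<Rightarrow> nat \<Rightarrow> nat \<Rightarrow> nat \<Rightarrow> real) \<Rightarrow>
    (nat \<Rightarrow> nat \<Rightarrow> real) \<Rightarrow> (nat \<Rightarrow> nat \<Rightarrow> real) \<Rightarrow> bool" where
  "better n Q y z \<longleftrightarrow> objective n Q y < objective n Q z"

definition shift_Q ::
  "nat \<Rightarrow> real \<Rightarrow> (nat \<Rightarrow> nat \<Rightarrow> nat \<Rightarrow> nat \<Rightarrow> real) \<Rightarrow>
    (nat \<Rightarrow> nat \<Rightarrow> nat \<Rightarrow> nat \<Rightarrow> real)" where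
  "shift_Q jhat \<Delta> Q u i v j = (if j \<noteq> jhat then Q u i v j else Q u i v j + \<Delta>)"

end

theory Submission
  imports Defs
begin

text \<open>
  Every feasible solution selects exactly one pair \<open>(v, jhat)\<close> in column \<open>jhat\<close>, and it
  pairs this choice with all \<open>n\<close> of its selected pairs \<open>(u, i)\<close>. So \<open>\<Delta>\<close> is picked up exactly
  \<open>n\<close> times, whatever the solution (\<open>objective_shift_Q_feasible\<close>): the two objectives differ
  by the constant \<open>n \<Delta>\<close> on the feasible set, and hence order it in the same way.
\<close>

text \<open>
  The objective is linear in the array, and the part of it that \<open>\<Delta>\<close> contributes factorises,
  because \<open>\<Delta>\<close> depends on none of \<open>u\<close>, \<open>i\<close>, \<open>v\<close>.
\<close>

lemma objective_shift_Q:
  assumes "jhat \<in> {1..n}"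
  shows "objective n (shift_Q jhat \<Delta> Q) x =
    objective n Q x + \<Delta> * (\<Sum>i=1..n. \<Sum>u=1..n. x u i) * (\<Sum>v=1..n. x v jhat)"
proof -
  have split: "(\<Sum>u=1..n. \<Sum>v=1..n. x u i * shift_Q jhat \<Delta> Q u i v j * x v j) =
      (\<Sum>u=1..n. \<Sum>v=1..n. x u i * Q u i v j * x v j) +
      (if j = jhat then \<Delta> * (\<Sum>u=1..n. x u i) * (\<Sum>v=1..n. x v jhat) else 0)" for i j
    by (simp add: shift_Q_def algebra_simps sum.distrib sum_product sum_distrib_left)
  show ?thesis
    unfolding objective_def split
    using assms by (simp add: sum.distrib flip: sum_distrib_left sum_distrib_right)
qed

lemma objective_shift_Q_feasible:
  assumes "jhat \<in> {1..n}" and "feasible n x"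
  shows "objective n (shift_Q jhat \<Delta> Q) x = objective n Q x + \<Delta> * real n"
proof -
  have column: "(\<Sum>u=1..n. x u i) = 1" if "i \<in> {1..n}" for i
    using assms(2) that by (simp add: feasible_def)
  then have "(\<Sum>i=1..n. \<Sum>u=1..n. x u i) = real n"
    by simp
  with column[OF assms(1)] show ?thesis
    by (simp add: objective_shift_Q[OF assms(1)])
qed

theorem lemma1:
  fixes n jhat :: nat
    and Q :: "nat \<Rightarrow> nat \<Rightarrow> nat \<Rightarrow> nat \<Rightarrow> real"
    and \<Delta> :: real
    and y z :: "nat \<Rightarrow> nat \<Rightarrow> real"
  assumes "n \<ge> 1"
    and "jhat \<in> {1..n}"
    and "feasible n y"
    and "feasible n z"
    and "better n Q y z"
  shows "better n (shift_Q jhat \<Delta> Q) y z"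
  using assms by (simp add: better_def objective_shift_Q_feasible)

end
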